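(* A functor $F\colon\mathsf{C}\to\mathsf{D}$ is full and surjective on objects if, and only if, $F$ is an extremal epimorphism and its generalized kernel $\mathrm{K}(F)$ is both a regular and a strong generalized congruence on $\mathsf{C}$, i.e. $\mathrm{K}(F)\in\mathrm{RgGCgr}(\mathsf{C})\cap\mathrm{SGCgr}(\mathsf{C})$.
   Context: Extremal epimorphisms are taken in $\mathsf{Cat}$, the category of all $\mathbf{U}$-categories (for a fixed Grothendieck universe $\mathbf{U}$, categories with object set included in $\mathbf{U}$ and hom-sets elements of $\mathbf{U}$) and functors between them. Let $\mathrm{sc}(f)$, $\mathrm{tg}(f)$ be the source and target of a morphism $f$, let $\mathrm{Mor}(\mathsf{C})^{+}$ be the set of finite nonempty sequences $(f_i)_{i\in m}=(f_0,\dots,f_{m-1})$ of morphisms of $\mathsf{C}$, let $(f)$ be the length-one sequence, and let $\curlywedge$ be concatenation. For an equivalence relation $E$ on $\mathrm{Ob}(\mathsf{C})$, $\mathrm{Mor}(\mathsf{C})^{+}_{E}$ is the set of $E$-composable sequences: those $(f_i)_{i\in m}$ with $(\mathrm{tg}(f_i),\mathrm{sc}(f_{i+1}))\in E$ for every $i\in m-1$. A generalized congruence on $\mathsf{C}$ is a pair $\Psi=(\Psi^{\mathrm{ob}},\Psi^{\mathrm{fl}})$ where $\Psi^{\mathrm{ob}}$ is an equivalence relation on $\mathrm{Ob}(\mathsf{C})$ and $\Psi^{\mathrm{fl}}$ is an equivalence relation on $\mathrm{Mor}(\mathsf{C})^{+}_{\Psi^{\mathrm{ob}}}$ such that: (a)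 if $(a,b)\in\Psi^{\mathrm{ob}}$, then $((\mathrm{id}_a),(\mathrm{id}_b))\in\Psi^{\mathrm{fl}}$; (b) if $((f_i)_{i\in m},(g_j)_{j\in n})\in\Psi^{\mathrm{fl}}$, then $(\mathrm{sc}(f_0),\mathrm{sc}(g_0))\in\Psi^{\mathrm{ob}}$ and $(\mathrm{tg}(f_{m-1}),\mathrm{tg}(g_{n-1}))\in\Psi^{\mathrm{ob}}$; (c) if $\mathrm{sc}(g)=\mathrm{tg}(f)$, then $((f,g),(g\circ f))\in\Psi^{\mathrm{fl}}$; (d) if $((f_i)_{i\in m},(f'_{i'})_{i'\in m'}),((g_j)_{j\in n},(g'_{j'})_{j'\in n'})\in\Psi^{\mathrm{fl}}$ and $(\mathrm{tg}(f_{m-1}),\mathrm{sc}(g_0))\in\Psi^{\mathrm{ob}}$, then $((f_i)_{i\in m}\curlywedge(g_j)_{j\in n},(f'_{i'})_{i'\in m'}\curlywedge(g'_{j'})_{j'\in n'})\in\Psi^{\mathrm{fl}}$. Inclusion of generalized congruences is coordinatewise; any relation on $(\mathrm{Ob}(\mathsf{C}),\mathrm{Mor}(\mathsf{C})^{+})$ generates a smallest generalized congruence containing it. $\Psi$ is strong if, for all $(a,a'),(b,b')\in\Psi^{\mathrm{ob}}$ and $f\in\mathrm{Hom}_{\mathsf{C}}(a,b)$, there is $f'\in\mathrm{Hom}_{\mathsf{C}}(a',b')$ with $((f),(f'))\in\Psi^{\mathrm{fl}}$; $\mathrm{SGCgr}(\mathsf{C})$ is the set of strong generalized congruences. $\Psi$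 is regular if it equals the generalized congruence generated by $(\Psi^{\mathrm{ob}},\{((f),(g))\mid ((f),(g))\in\Psi^{\mathrm{fl}}\})$; $\mathrm{RgGCgr}(\mathsf{C})$ is the set of regular generalized congruences. The generalized kernel $\mathrm{K}(F)$ of a functor $F\colon\mathsf{C}\to\mathsf{D}$ is the generalized congruence on $\mathsf{C}$ with $(a,b)\in\mathrm{K}(F)^{\mathrm{ob}}$ iff $F(a)=F(b)$ and, for $(f_i)_{i\in m},(g_j)_{j\in n}\in\mathrm{Mor}(\mathsf{C})^{+}_{\mathrm{K}(F)^{\mathrm{ob}}}$, $((f_i)_{i\in m},(g_j)_{j\in n})\in\mathrm{K}(F)^{\mathrm{fl}}$ iff $F(f_{m-1})\circ\cdots\circ F(f_0)=F(g_{n-1})\circ\cdots\circ F(g_0)$ in $\mathsf{D}$. *)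

theory Defs
  imports Main "HOL-Library.FuncSet"
begin

section \<open>The universe\<close>

text \<open>
  The fixed Grothendieck universe \<open>\<^bold>U\<close> is a type \<open>'u\<close>, whose inhabitants are the elements of
  \<open>\<^bold>U\<close>, together with \<open>elts :: 'u \<Rightarrow> 'u set\<close> sending an element of \<open>\<^bold>U\<close> to its set of
  elements (so transitivity of \<open>\<^bold>U\<close> is built into the typing). A subset of \<open>\<^bold>U\<close> is a value of
  type \<open>'u set\<close>; it is an element of \<open>\<^bold>U\<close> iff it lies in \<open>range elts\<close>. The first two axioms are
  extensionality and foundation of membership, the others are closure under pairs, power sets and
  unions of families indexed by an element of \<open>\<^bold>U\<close>. The axiom \<open>\<omega> \<in> \<^bold>U\<close>, which only some authors
  include, is not required, so both conventions are covered.
\<close>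

locale grothendieck_universe =
  fixes elts :: "'u \<Rightarrow> 'u set"
  assumes extensionality: "inj elts"
    and foundation: "wf {(x, y). x \<in> elts y}"
    and pairing: "\<exists>p. elts p = {x, y}"
    and power: "\<exists>p. elts ` elts p = Pow (elts x)"
    and family_union: "\<exists>u. elts u = (\<Union>i\<in>elts x. elts (f i))"


section \<open>Categories and functors\<close>

text \<open>Only the values of the operations on \<open>Ob\<close> and \<open>Mor\<close> (and on composable pairs) matter;
  \<open>comp C g f\<close> is \<open>g \<circ> f\<close>.\<close>

record 'u category =
  Ob :: "'u set"
  Mor :: "'u set"
  sc :: "'u \<Rightarrow> 'u"
  tg :: "'u \<Rightarrow> 'u"
  ident :: "'u \<Rightarrow> 'u"
  comp :: "'u \<Rightarrow> 'u \<Rightarrow> 'u"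

definition Hom :: "'u category \<Rightarrow> 'u \<Rightarrow> 'u \<Rightarrow> 'u set" where
  "Hom C a b = {f \<in> Mor C. sc C f = a \<and> tg C f = b}"

locale category =
  fixes C :: "'u category"
  assumes sc_in: "f \<in> Mor C \<Longrightarrow> sc C f \<in> Ob C"
    and tg_in: "f \<in> Mor C \<Longrightarrow> tg C f \<in> Ob C"
    and ident_in: "a \<in> Ob C \<Longrightarrow> ident C a \<in> Hom C a a"
    and comp_in: "\<lbrakk>f \<in> Hom C a b; g \<in> Hom C b c\<rbrakk> \<Longrightarrow> comp C g f \<in> Hom C a c"
    and ident_right: "f \<in> Hom C a b \<Longrightarrow> comp C f (ident C a) = f"
    and ident_left: "f \<in> Hom C a b \<Longrightarrow> comp C (ident C b) f = f"
    and assoc: "\<lbrakk>f \<in> Hom C a b; g \<in> Hom C b c; h \<in> Hom C c d\<rbrakk>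
      \<Longrightarrow> comp C h (comp C g f) = comp C (comp C h g) f"

text \<open>The objects of \<open>\<^bold>U\<close>-categories form an arbitrary subset of \<open>\<^bold>U\<close>; only the hom-sets are
  required to be elements of \<open>\<^bold>U\<close>.\<close>

definition U_categories :: "('u \<Rightarrow> 'u set) \<Rightarrow> 'u category set" where
  "U_categories elts =
    {C. category C \<and> (\<forall>a\<in>Ob C. \<forall>b\<in>Ob C. Hom C a b \<in> range elts)}"

record 'u cat_functor =
  omap :: "'u \<Rightarrow> 'u"
  mmap :: "'u \<Rightarrow> 'u"

text \<open>The maps are extensional (\<open>undefined\<close> off \<open>Ob C\<close> and \<open>Mor C\<close>), so that HOL equality
  of functors from \<open>C\<close> to \<open>D\<close> is the mathematical one.\<close>

definition Functors :: "'u category \<Rightarrow> 'u category \<Rightarrow> 'u cat_functor set" where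
  "Functors C D = {F. omap F \<in> Ob C \<rightarrow>\<^sub>E Ob D \<and> mmap F \<in> Mor C \<rightarrow>\<^sub>E Mor D \<and>
    (\<forall>f\<in>Mor C. sc D (mmap F f) = omap F (sc C f) \<and> tg D (mmap F f) = omap F (tg C f)) \<and>
    (\<forall>a\<in>Ob C. mmap F (ident C a) = ident D (omap F a)) \<and>
    (\<forall>f\<in>Mor C. \<forall>g\<in>Mor C. sc C g = tg C f \<longrightarrow>
      mmap F (comp C g f) = comp D (mmap F g) (mmap F f))}"

definition id_functor :: "'u category \<Rightarrow> 'u cat_functor" where
  "id_functor C = \<lparr>omap = restrict id (Ob C), mmap = restrict id (Mor C)\<rparr>"

text \<open>\<open>comp_functor C G F\<close> is \<open>G \<circ> F\<close> for \<open>F\<close> with domain \<open>C\<close>.\<close>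

definition comp_functor :: "'u category \<Rightarrow> 'u cat_functor \<Rightarrow> 'u cat_functor \<Rightarrow> 'u cat_functor" where
  "comp_functor C G F =
    \<lparr>omap = compose (Ob C) (omap G) (omap F), mmap = compose (Mor C) (mmap G) (mmap F)\<rparr>"

definition full_functor :: "'u category \<Rightarrow> 'u category \<Rightarrow> 'u cat_functor \<Rightarrow> bool" where
  "full_functor C D F \<longleftrightarrow>
    (\<forall>a\<in>Ob C. \<forall>b\<in>Ob C. mmap F ` Hom C a b = Hom D (omap F a) (omap F b))"

definition surjective_on_objects ::
    "'u category \<Rightarrow> 'u category \<Rightarrow> 'u cat_functor \<Rightarrow> bool" where
  "surjective_on_objects C D F \<longleftrightarrow> omap F ` Ob C = Ob D"


section \<open>Extremal epimorphisms in the category of \<open>\<^bold>U\<close>-categories\<close>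

definition mono_Cat ::
    "('u \<Rightarrow> 'u set) \<Rightarrow> 'u category \<Rightarrow> 'u category \<Rightarrow> 'u cat_functor \<Rightarrow> bool" where
  "mono_Cat elts C D M \<longleftrightarrow> M \<in> Functors C D \<and>
    (\<forall>X\<in>U_categories elts. \<forall>G\<in>Functors X C. \<forall>H\<in>Functors X C.
      comp_functor X M G = comp_functor X M H \<longrightarrow> G = H)"

definition epi_Cat ::
    "('u \<Rightarrow> 'u set) \<Rightarrow> 'u category \<Rightarrow> 'u category \<Rightarrow> 'u cat_functor \<Rightarrow> bool" where
  "epi_Cat elts C D F \<longleftrightarrow> F \<in> Functors C D \<and>
    (\<forall>X\<in>U_categories elts. \<forall>G\<in>Functors D X. \<forall>H\<in>Functors D X.
      comp_functor C G F = comp_functor C H F \<longrightarrow> G = H)"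

definition iso_Cat :: "'u category \<Rightarrow> 'u category \<Rightarrow> 'u cat_functor \<Rightarrow> bool" where
  "iso_Cat C D F \<longleftrightarrow> F \<in> Functors C D \<and>
    (\<exists>G\<in>Functors D C. comp_functor C G F = id_functor C \<and> comp_functor D F G = id_functor D)"

definition extremal_epi_Cat ::
    "('u \<Rightarrow> 'u set) \<Rightarrow> 'u category \<Rightarrow> 'u category \<Rightarrow> 'u cat_functor \<Rightarrow> bool" where
  "extremal_epi_Cat elts C D F \<longleftrightarrow> epi_Cat elts C D F \<and>
    (\<forall>X\<in>U_categories elts. \<forall>G\<in>Functors C X. \<forall>M.
      mono_Cat elts X D M \<and> F = comp_functor C M G \<longrightarrow> iso_Cat X D M)"


section \<open>Generalized congruences\<close>

definition Mor_seqs :: "'u category \<Rightarrow> 'u list set" where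
  "Mor_seqs C = {fs. fs \<noteq> [] \<and> set fs \<subseteq> Mor C}"

definition composable_seqs :: "'u category \<Rightarrow> ('u \<times> 'u) set \<Rightarrow> 'u list set" where
  "composable_seqs C E =
    {fs \<in> Mor_seqs C. \<forall>i. Suc i < length fs \<longrightarrow> (tg C (fs ! i), sc C (fs ! Suc i)) \<in> E}"

type_synonym 'u gpair = "('u \<times> 'u) set \<times> ('u list \<times> 'u list) set"

definition GCgr :: "'u category \<Rightarrow> 'u gpair set" where
  "GCgr C = {(E, R). equiv (Ob C) E \<and> equiv (composable_seqs C E) R \<and>
    (\<forall>a b. (a, b) \<in> E \<longrightarrow> ([ident C a], [ident C b]) \<in> R) \<and>
    (\<forall>fs gs. (fs, gs) \<in> R \<longrightarrow>
      (sc C (hd fs), sc C (hd gs)) \<in> E \<and> (tg C (last fs), tg C (last gs)) \<in> E) \<and>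
    (\<forall>f\<in>Mor C. \<forall>g\<in>Mor C. sc C g = tg C f \<longrightarrow> ([f, g], [comp C g f]) \<in> R) \<and>
    (\<forall>fs fs' gs gs'. (fs, fs') \<in> R \<and> (gs, gs') \<in> R \<and> (tg C (last fs), sc C (hd gs)) \<in> E \<longrightarrow>
      (fs @ gs, fs' @ gs') \<in> R)}"

text \<open>The smallest generalized congruence containing \<open>S\<close> is the coordinatewise intersection of all
  those containing it (see \<open>generated_GCgr_least\<close> below).\<close>

definition generated_GCgr :: "'u category \<Rightarrow> 'u gpair \<Rightarrow> 'u gpair" where
  "generated_GCgr C S =
    (let K = {\<Psi> \<in> GCgr C. fst S \<subseteq> fst \<Psi> \<and> snd S \<subseteq> snd \<Psi>}
     in (\<Inter>\<Psi>\<in>K. fst \<Psi>, \<Inter>\<Psi>\<in>K. snd \<Psi>))"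

definition SGCgr :: "'u category \<Rightarrow> 'u gpair set" where
  "SGCgr C = {(E, R) \<in> GCgr C. \<forall>a a' b b' f.
    (a, a') \<in> E \<and> (b, b') \<in> E \<and> f \<in> Hom C a b \<longrightarrow> (\<exists>f'\<in>Hom C a' b'. ([f], [f']) \<in> R)}"

definition RgGCgr :: "'u category \<Rightarrow> 'u gpair set" where
  "RgGCgr C = {(E, R) \<in> GCgr C.
    (E, R) = generated_GCgr C (E, {([f], [g]) | f g. ([f], [g]) \<in> R})}"

text \<open>\<open>comp_seq C [f\<^sub>0, \<dots>, f\<^sub>n]\<close> is the composite \<open>f\<^sub>n \<circ> \<cdots> \<circ> f\<^sub>0\<close>.\<close>

fun comp_seq :: "'u category \<Rightarrow> 'u list \<Rightarrow> 'u" where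
  "comp_seq C [f] = f"
| "comp_seq C (f # g # fs) = comp C (comp_seq C (g # fs)) f"

definition kernel_ob :: "'u category \<Rightarrow> 'u cat_functor \<Rightarrow> ('u \<times> 'u) set" where
  "kernel_ob C F = {(a, b). a \<in> Ob C \<and> b \<in> Ob C \<and> omap F a = omap F b}"

definition gen_kernel :: "'u category \<Rightarrow> 'u category \<Rightarrow> 'u cat_functor \<Rightarrow> 'u gpair" where
  "gen_kernel C D F = (kernel_ob C F,
    {(fs, gs). fs \<in> composable_seqs C (kernel_ob C F) \<and> gs \<in> composable_seqs C (kernel_ob C F) \<and>
      comp_seq D (map (mmap F) fs) = comp_seq D (map (mmap F) gs)})"

lemma composable_seqs_append:
  assumes "fs \<in> composable_seqs C E" "gs \<in> composable_seqs C E" "(tg C (last fs), sc C (hd gs)) \<in> E"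
  shows "fs @ gs \<in> composable_seqs C E"
proof -
  have "(tg C ((fs @ gs) ! i), sc C ((fs @ gs) ! Suc i)) \<in> E" if i: "Suc i < length (fs @ gs)" for i
  proof -
    consider "Suc i < length fs" | "Suc i = length fs" | "length fs \<le> i" by linarith
    then show ?thesis
    proof cases
      case 1
      then show ?thesis using assms(1) by (auto simp: composable_seqs_def nth_append)
    next
      case 2
      then have "(fs @ gs) ! i = last fs" "(fs @ gs) ! Suc i = hd gs"
        using assms(1,2)
        by (auto simp: composable_seqs_def Mor_seqs_def nth_append last_conv_nth hd_conv_nth
            simp flip: 2)
      then show ?thesis using assms(3) by simp
    next
      case 3
      then have "Suc (i - length fs) < length gs" using i by auto
      then show ?thesis using assms(2) 3 by (auto simp: composable_seqs_def nth_append Suc_diff_le)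
    qed
  qed
  then show ?thesis using assms by (auto simp: composable_seqs_def Mor_seqs_def)
qed

lemma total_in_GCgr:
  assumes "category C"
  shows "(Ob C \<times> Ob C, Mor_seqs C \<times> Mor_seqs C) \<in> GCgr C"
proof -
  interpret category C by fact
  have [simp]: "composable_seqs C (Ob C \<times> Ob C) = Mor_seqs C"
    by (auto simp: composable_seqs_def Mor_seqs_def sc_in tg_in subset_iff)
  have "comp C g f \<in> Mor C" if "f \<in> Mor C" "g \<in> Mor C" "sc C g = tg C f" for f g
    using comp_in[of f "sc C f" "tg C f" g "tg C g"] that by (auto simp: Hom_def)
  moreover have "ident C a \<in> Mor C" if "a \<in> Ob C" for a
    using ident_in[OF that] by (auto simp: Hom_def)
  ultimately show ?thesis
    by (auto simp: GCgr_def Mor_seqs_def equiv_def refl_on_def sym_def trans_def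
        intro!: sc_in tg_in dest: subsetD[OF _ hd_in_set] subsetD[OF _ last_in_set])
qed

lemma generated_GCgr_least:
  assumes "category C" "fst S \<subseteq> Ob C \<times> Ob C" "snd S \<subseteq> Mor_seqs C \<times> Mor_seqs C"
  shows "generated_GCgr C S \<in> GCgr C"
    and "fst S \<subseteq> fst (generated_GCgr C S)" "snd S \<subseteq> snd (generated_GCgr C S)"
    and "\<lbrakk>\<Psi> \<in> GCgr C; fst S \<subseteq> fst \<Psi>; snd S \<subseteq> snd \<Psi>\<rbrakk>
      \<Longrightarrow> fst (generated_GCgr C S) \<subseteq> fst \<Psi> \<and> snd (generated_GCgr C S) \<subseteq> snd \<Psi>"
proof -
  define K where "K = {\<Psi> \<in> GCgr C. fst S \<subseteq> fst \<Psi> \<and> snd S \<subseteq> snd \<Psi>}"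
  define E where "E = (\<Inter>\<Psi>\<in>K. fst \<Psi>)"
  define R where "R = (\<Inter>\<Psi>\<in>K. snd \<Psi>)"
  have gen: "generated_GCgr C S = (E, R)"
    by (simp add: generated_GCgr_def Let_def K_def E_def R_def)
  have ne: "K \<noteq> {}"
    using total_in_GCgr[OF assms(1)] assms(2,3) unfolding K_def by fastforce
  have K: "equiv (Ob C) (fst \<Psi>)" "equiv (composable_seqs C (fst \<Psi>)) (snd \<Psi>)"
    "\<And>a b. (a, b) \<in> fst \<Psi> \<Longrightarrow> ([ident C a], [ident C b]) \<in> snd \<Psi>"
    "\<And>fs gs. (fs, gs) \<in> snd \<Psi> \<Longrightarrow>
      (sc C (hd fs), sc C (hd gs)) \<in> fst \<Psi> \<and> (tg C (last fs), tg C (last gs)) \<in> fst \<Psi>"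
    "\<And>f g. \<lbrakk>f \<in> Mor C; g \<in> Mor C; sc C g = tg C f\<rbrakk> \<Longrightarrow> ([f, g], [comp C g f]) \<in> snd \<Psi>"
    "\<And>fs fs' gs gs'. \<lbrakk>(fs, fs') \<in> snd \<Psi>; (gs, gs') \<in> snd \<Psi>; (tg C (last fs), sc C (hd gs)) \<in> fst \<Psi>\<rbrakk>
      \<Longrightarrow> (fs @ gs, fs' @ gs') \<in> snd \<Psi>"
    if "\<Psi> \<in> K" for \<Psi>
    using that by (auto simp: K_def GCgr_def)
  have eqE: "equiv (Ob C) E"
  proof (rule equivI)
    show "E \<subseteq> Ob C \<times> Ob C" using ne K(1) by (fastforce simp: E_def equiv_def)
    show "refl_on (Ob C) E" using K(1) by (fastforce simp: E_def equiv_def refl_on_def)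
    show "sym E" using K(1) by (fastforce simp: E_def equiv_def sym_def)
    show "trans E"
      unfolding trans_def E_def using K(1)
      by (simp only: INT_iff, intro allI impI ballI) (meson equivE transD)
  qed
  have sub: "R \<subseteq> composable_seqs C E \<times> composable_seqs C E"
  proof clarify
    fix fs gs assume fg: "(fs, gs) \<in> R"
    have "fs \<in> composable_seqs C (fst \<Psi>) \<and> gs \<in> composable_seqs C (fst \<Psi>)" if "\<Psi> \<in> K" for \<Psi>
      using K(2)[OF that] fg that by (auto simp: R_def equiv_def)
    then show "fs \<in> composable_seqs C E \<and> gs \<in> composable_seqs C E"
      using ne by (auto simp: composable_seqs_def E_def)
  qed
  have eqR: "equiv (composable_seqs C E) R"
  proof (rule equivI)
    show "R \<subseteq> composable_seqs C E \<times> composable_seqs C E" by (rule sub)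
    show "refl_on (composable_seqs C E) R"
    proof (rule refl_onI)
      fix fs assume fs: "fs \<in> composable_seqs C E"
      have "(fs, fs) \<in> snd \<Psi>" if "\<Psi> \<in> K" for \<Psi>
      proof -
        have "fs \<in> composable_seqs C (fst \<Psi>)"
          using fs that by (auto simp: composable_seqs_def E_def)
        then show ?thesis using K(2)[OF that] by (auto simp: equiv_def refl_on_def)
      qed
      then show "(fs, fs) \<in> R" by (auto simp: R_def)
    qed
    show "sym R" using K(2) by (fastforce simp: R_def equiv_def sym_def)
    show "trans R"
      unfolding trans_def R_def using K(2)
      by (simp only: INT_iff, intro allI impI ballI) (meson equivE transD)
  qed
  show "generated_GCgr C S \<in> GCgr C"
    unfolding gen GCgr_def using eqE eqR K(3-6) by (auto simp: E_def R_def)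
  show "fst S \<subseteq> fst (generated_GCgr C S)" "snd S \<subseteq> snd (generated_GCgr C S)"
    by (auto simp: generated_GCgr_def Let_def)
  show "fst (generated_GCgr C S) \<subseteq> fst \<Psi> \<and> snd (generated_GCgr C S) \<subseteq> snd \<Psi>"
    if "\<Psi> \<in> GCgr C" "fst S \<subseteq> fst \<Psi>" "snd S \<subseteq> snd \<Psi>"
    using that by (auto simp: generated_GCgr_def Let_def)
qed

end

theory Submission
  imports Defs
begin

text \<open>
  If \<open>F\<close> is full and surjective on objects, then it is surjective on morphisms, so it is an
  epimorphism. A monomorphism of \<open>\<^bold>U\<close>-categories is injective on morphisms, because morphisms are
  the functors out of the walking arrow, which can be realised inside any universe. Hence a
  monomorphism through which \<open>F\<close> factors is bijective on morphisms, that is, an isomorphism.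
  Fullness lets a morphism be transported, without changing its image, between any two pairs of
  objects with the same images; this says that the kernel is strong (\<open>gen_kernel_strong_iff\<close>).
  Finally, every strong generalized congruence is regular (\<open>strong_imp_regular\<close>): transporting the
  entries of a composable sequence one after the other makes their sources and targets match, so
  that up to pairs of single morphisms the sequence is equivalent to an honest composite.

  Conversely, if the kernel is strong, the same transport shows that the images \<open>F(f)\<close> are closed
  under composition, so they form a subcategory of \<open>D\<close>. The functor \<open>F\<close> factors through its
  inclusion, which is a monomorphism; extremality makes the inclusion an isomorphism. Thus every
  morphism of \<open>D\<close> is some \<open>F(f)\<close>, and transporting \<open>f\<close> to prescribed source and target gives
  fullness.
\<close>

section \<open>Categories and functors\<close>

lemma (in category) comp_Mor:
  assumes "f \<in> Mor C" "g \<in> Mor C" "sc C g = tg C f"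
  shows "comp C g f \<in> Mor C" "sc C (comp C g f) = sc C f" "tg C (comp C g f) = tg C g"
  using comp_in[of f "sc C f" "tg C f" g "tg C g"] assms by (auto simp: Hom_def)

lemma (in category) ident_Mor:
  assumes "a \<in> Ob C"
  shows "ident C a \<in> Mor C" "sc C (ident C a) = a" "tg C (ident C a) = a"
  using ident_in[OF assms] by (auto simp: Hom_def)

lemma FunctorsD:
  assumes "F \<in> Functors C D"
  shows "a \<in> Ob C \<Longrightarrow> omap F a \<in> Ob D"
    and "f \<in> Mor C \<Longrightarrow> mmap F f \<in> Mor D"
    and "f \<in> Mor C \<Longrightarrow> sc D (mmap F f) = omap F (sc C f)"
    and "f \<in> Mor C \<Longrightarrow> tg D (mmap F f) = omap F (tg C f)"
    and "a \<in> Ob C \<Longrightarrow> mmap F (ident C a) = ident D (omap F a)"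
    and "\<lbrakk>f \<in> Mor C; g \<in> Mor C; sc C g = tg C f\<rbrakk>
      \<Longrightarrow> mmap F (comp C g f) = comp D (mmap F g) (mmap F f)"
  using assms by (auto simp: Functors_def dest: PiE_mem)

lemma comp_functor_apply:
  "a \<in> Ob C \<Longrightarrow> omap (comp_functor C G F) a = omap G (omap F a)"
  "f \<in> Mor C \<Longrightarrow> mmap (comp_functor C G F) f = mmap G (mmap F f)"
  by (simp_all add: comp_functor_def compose_def)

lemma id_functor_apply:
  "a \<in> Ob C \<Longrightarrow> omap (id_functor C) a = a"
  "f \<in> Mor C \<Longrightarrow> mmap (id_functor C) f = f"
  by (simp_all add: id_functor_def)

lemma comp_functor_in:
  assumes "category B" "F \<in> Functors B C" "G \<in> Functors C D"
  shows "comp_functor B G F \<in> Functors B D"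
proof -
  interpret category B by fact
  show ?thesis
    unfolding Functors_def using FunctorsD[OF assms(2)] FunctorsD[OF assms(3)]
    by (auto simp: comp_functor_apply comp_Mor ident_Mor sc_in tg_in)
      (auto simp: comp_functor_def compose_def)
qed

lemma id_functor_in:
  assumes "category C"
  shows "id_functor C \<in> Functors C C"
proof -
  interpret category C by fact
  show ?thesis
    by (auto simp: Functors_def id_functor_apply comp_Mor ident_Mor sc_in tg_in)
      (auto simp: id_functor_def)
qed

text \<open>Objects are recovered from their identities, so agreement on morphisms suffices.\<close>

lemma functor_eqI:
  assumes C: "category C" and G: "G \<in> Functors C D" and H: "H \<in> Functors C D"
    and eq: "\<And>f. f \<in> Mor C \<Longrightarrow> mmap G f = mmap H f"
  shows "G = H"
proof -
  interpret category C by fact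
  have "omap G a = omap H a" if a: "a \<in> Ob C" for a
    using FunctorsD(3)[OF G, of "ident C a"] FunctorsD(3)[OF H, of "ident C a"] eq ident_Mor[OF a]
    by simp
  then have "omap G = omap H"
    using G H by (intro PiE_ext[of _ "Ob C" "\<lambda>_. Ob D"]) (auto simp: Functors_def)
  moreover have "mmap G = mmap H"
    using G H eq by (intro PiE_ext[of _ "Mor C" "\<lambda>_. Mor D"]) (auto simp: Functors_def)
  ultimately show ?thesis by (cases G; cases H) simp
qed

text \<open>The inverse on objects is again determined by identities, so bijectivity on morphisms is
  all that is needed.\<close>

lemma iso_CatI:
  assumes C: "category C" and D: "category D" and F: "F \<in> Functors C D"
    and bij: "bij_betw (mmap F) (Mor C) (Mor D)"
  shows "iso_Cat C D F"
proof -
  interpret C: category C by fact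
  interpret D: category D by fact
  note FD = FunctorsD[OF F]
  have inj: "f = g" if "mmap F f = mmap F g" "f \<in> Mor C" "g \<in> Mor C" for f g
    using bij that by (auto simp: bij_betw_def inj_on_def)
  have inj_ob: "a = b" if "omap F a = omap F b" "a \<in> Ob C" "b \<in> Ob C" for a b
  proof -
    have "ident C a = ident C b"
      by (rule inj) (use that FD(5)[of a] FD(5)[of b] in \<open>auto simp: C.ident_Mor\<close>)
    then show ?thesis using C.ident_Mor(2) that by metis
  qed
  define m where "m = inv_into (Mor C) (mmap F)"
  have m: "m d \<in> Mor C" "mmap F (m d) = d" if "d \<in> Mor D" for d
    using bij that unfolding m_def
    by (auto simp: bij_betw_def inv_into_into f_inv_into_f)
  define p where "p = (\<lambda>x. sc C (m (ident D x)))"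
  have p: "p x \<in> Ob C" "omap F (p x) = x" if "x \<in> Ob D" for x
    using FD(3)[of "m (ident D x)"] m[of "ident D x"] D.ident_Mor[OF that]
    by (auto simp: p_def C.sc_in)
  have p_omap: "p (omap F a) = a" if "a \<in> Ob C" for a
    by (rule inj_ob) (use that p FD(1) in auto)
  have m_sc: "sc C (m d) = p (sc D d)" and m_tg: "tg C (m d) = p (tg D d)" if "d \<in> Mor D" for d
    using m[OF that] FD(3)[of "m d"] FD(4)[of "m d"] by (simp_all add: p_omap C.sc_in C.tg_in)
  define G where "G = \<lparr>omap = restrict p (Ob D), mmap = restrict m (Mor D)\<rparr>"
  have "m (ident D x) = ident C (p x)" if "x \<in> Ob D" for x
    by (rule inj) (use that p[OF that] m[of "ident D x"] FD(5)[of "p x"] in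
      \<open>auto simp: C.ident_Mor D.ident_Mor\<close>)
  moreover have "m (comp D e d) = comp C (m e) (m d)"
    if "d \<in> Mor D" "e \<in> Mor D" "sc D e = tg D d" for d e
    by (rule inj) (use that m[of d] m[of e] m[of "comp D e d"] FD(6)[of "m d" "m e"] in
      \<open>auto simp: C.comp_Mor D.comp_Mor m_sc m_tg\<close>)
  ultimately have G: "G \<in> Functors D C"
    using p m by (auto simp: Functors_def G_def m_sc m_tg D.sc_in D.tg_in D.comp_Mor D.ident_Mor)
  have "m (mmap F f) = f" if "f \<in> Mor C" for f
    by (rule inj) (use that m FD(2) in auto)
  then have "comp_functor C G F = id_functor C"
    using FD(2)
    by (intro functor_eqI[OF C comp_functor_in[OF C F G] id_functor_in[OF C]])
      (simp add: comp_functor_apply id_functor_apply G_def)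
  moreover have "comp_functor D F G = id_functor D"
    using m
    by (intro functor_eqI[OF D comp_functor_in[OF D G F] id_functor_in[OF D]])
      (simp add: comp_functor_apply id_functor_apply G_def)
  ultimately show ?thesis using F G by (auto simp: iso_Cat_def)
qed

lemma iso_Cat_surjective:
  assumes iso: "iso_Cat C D F"
  shows "omap F ` Ob C = Ob D" "mmap F ` Mor C = Mor D"
proof -
  obtain G where F: "F \<in> Functors C D" and G: "G \<in> Functors D C"
    and FG: "comp_functor D F G = id_functor D"
    using iso by (auto simp: iso_Cat_def)
  have "x \<in> omap F ` Ob C" if "x \<in> Ob D" for x
    using comp_functor_apply(1)[OF that, of F G] FunctorsD(1)[OF G that]
    by (metis FG id_functor_apply(1) imageI that)
  then show "omap F ` Ob C = Ob D" using FunctorsD(1)[OF F] by auto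
  have "d \<in> mmap F ` Mor C" if "d \<in> Mor D" for d
    using comp_functor_apply(2)[OF that, of F G] FunctorsD(2)[OF G that]
    by (metis FG id_functor_apply(2) imageI that)
  then show "mmap F ` Mor C = Mor D" using FunctorsD(2)[OF F] by auto
qed


section \<open>Monomorphisms of categories are injective\<close>

lemma (in grothendieck_universe) subset_in_universe:
  assumes "A \<subseteq> elts x"
  shows "A \<in> range elts"
proof -
  obtain p where "elts ` elts p = Pow (elts x)" using power[of x] by (elim exE)
  then have "A \<in> elts ` elts p" using assms by simp
  then show ?thesis by auto
qed

lemma (in grothendieck_universe) empty_in_universe: "{} \<in> range elts"
  using subset_in_universe[of "{}" undefined] by simp

lemma (in grothendieck_universe) singleton_in_universe: "{x} \<in> range elts"
  using pairing[of x x] by (auto intro: range_eqI sym)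

text \<open>The sets \<open>\<emptyset>\<close>, \<open>{\<emptyset>}\<close>, \<open>{{\<emptyset>}}\<close> provide the three morphisms of the walking arrow.\<close>

lemma (in grothendieck_universe) three_elements:
  obtains e s t :: 'u where "e \<noteq> s" "e \<noteq> t" "s \<noteq> t"
proof -
  obtain e where e: "elts e = {}" using empty_in_universe by auto
  obtain s where s: "elts s = {e}" using singleton_in_universe[of e] by auto
  obtain t where t: "elts t = {s}" using singleton_in_universe[of s] by auto
  have "e \<noteq> s" "e \<noteq> t" using e s t by auto
  moreover from this have "s \<noteq> t" using s t by auto
  ultimately show ?thesis by (rule that)
qed

text \<open>Objects and identities of the walking arrow share the names \<open>e\<close> and \<open>s\<close>; the arrow \<open>t\<close> goes
  from \<open>e\<close> to \<open>s\<close>.\<close>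

definition walking_arrow :: "'u \<Rightarrow> 'u \<Rightarrow> 'u \<Rightarrow> 'u category" where
  "walking_arrow e s t = \<lparr>Ob = {e, s}, Mor = {e, s, t},
    sc = (\<lambda>f. if f = t then e else f), tg = (\<lambda>f. if f = t then s else f),
    ident = (\<lambda>a. a), comp = (\<lambda>g f. if f = t \<or> g = t then t else f)\<rparr>"

lemma (in grothendieck_universe) walking_arrow_U_category:
  assumes "e \<noteq> s" "e \<noteq> t" "s \<noteq> t"
  shows "walking_arrow e s t \<in> U_categories elts"
proof -
  have Hom: "Hom (walking_arrow e s t) a b \<in> {{}, {e}, {s}, {t}}" for a b
    using assms by (auto simp: Hom_def walking_arrow_def)
  have "category (walking_arrow e s t)"
    by unfold_locales (use assms in \<open>auto simp: Hom_def walking_arrow_def split: if_splits\<close>)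
  then show ?thesis
    using Hom empty_in_universe singleton_in_universe
    unfolding U_categories_def by (smt (verit) insert_iff mem_Collect_eq singletonD)
qed

text \<open>A morphism \<open>f\<close> of \<open>C\<close>, regarded as a functor from the walking arrow to \<open>C\<close>.\<close>

definition arrow_functor :: "'u \<Rightarrow> 'u \<Rightarrow> 'u \<Rightarrow> 'u category \<Rightarrow> 'u \<Rightarrow> 'u cat_functor" where
  "arrow_functor e s t C f = \<lparr>
    omap = (\<lambda>a\<in>{e, s}. if a = e then sc C f else tg C f),
    mmap = (\<lambda>k\<in>{e, s, t}. if k = t then f else ident C (if k = e then sc C f else tg C f))\<rparr>"

lemma arrow_functor_in:
  assumes "category C" "f \<in> Mor C" and ne: "e \<noteq> s" "e \<noteq> t" "s \<noteq> t"
  shows "arrow_functor e s t C f \<in> Functors (walking_arrow e s t) C"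
proof -
  interpret category C by fact
  have "comp C f (ident C (sc C f)) = f" "comp C (ident C (tg C f)) f = f"
    using assms(2) by (auto intro: ident_right ident_left simp: Hom_def)
  moreover have "comp C (ident C a) (ident C a) = ident C a" if "a \<in> Ob C" for a
    using ident_right[OF ident_in[OF that]] .
  ultimately show ?thesis
    using assms
    by (auto simp: Functors_def arrow_functor_def walking_arrow_def ident_Mor sc_in tg_in)
qed

text \<open>Two morphisms with the same image yield, as functors from the walking arrow, two functors
  that become equal after composing with \<open>M\<close>.\<close>

lemma mono_Cat_inj:
  assumes U: "grothendieck_universe elts" and C: "category C"
    and M: "mono_Cat elts C D M"
  shows "inj_on (mmap M) (Mor C)"
proof (rule inj_onI)
  fix f g assume f: "f \<in> Mor C" and g: "g \<in> Mor C" and eq: "mmap M f = mmap M g"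
  interpret grothendieck_universe elts by fact
  interpret C: category C by fact
  obtain e s t :: 'a where ne: "e \<noteq> s" "e \<noteq> t" "s \<noteq> t" by (rule three_elements)
  let ?X = "walking_arrow e s t" and ?G = "arrow_functor e s t C"
  have X: "?X \<in> U_categories elts" "category ?X"
    using walking_arrow_U_category[OF ne] by (auto simp: U_categories_def)
  have MF: "M \<in> Functors C D" using M by (simp add: mono_Cat_def)
  note G = arrow_functor_in[OF C f ne] arrow_functor_in[OF C g ne]
  have ob: "omap M (sc C f) = omap M (sc C g)" "omap M (tg C f) = omap M (tg C g)"
    using FunctorsD(3,4)[OF MF f] FunctorsD(3,4)[OF MF g] eq by simp_all
  have "comp_functor ?X M (?G f) = comp_functor ?X M (?G g)"
  proof (rule functor_eqI[OF X(2) comp_functor_in[OF X(2) G(1) MF] comp_functor_in[OF X(2) G(2) MF]])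
    fix k assume "k \<in> Mor ?X"
    then show "mmap (comp_functor ?X M (?G f)) k = mmap (comp_functor ?X M (?G g)) k"
      using eq ob f g ne FunctorsD(5)[OF MF]
      by (auto simp: comp_functor_apply arrow_functor_def walking_arrow_def C.sc_in C.tg_in)
  qed
  then have "?G f = ?G g" using M X(1) G by (auto simp: mono_Cat_def)
  then have "mmap (?G f) t = mmap (?G g) t" by simp
  then show "f = g" by (simp add: arrow_functor_def)
qed


section \<open>Composable sequences and the generalized kernel\<close>

lemma composable_seqs_single: "[f] \<in> composable_seqs C E \<longleftrightarrow> f \<in> Mor C"
  by (auto simp: composable_seqs_def Mor_seqs_def)

lemma composable_seqs_Cons:
  "f # g # fs \<in> composable_seqs C E \<longleftrightarrow>
    f \<in> Mor C \<and> (tg C f, sc C g) \<in> E \<and> g # fs \<in> composable_seqs C E" (is "?L \<longleftrightarrow> ?R")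
proof
  assume L: ?L
  then have "(tg C ((f # g # fs) ! i), sc C ((f # g # fs) ! Suc i)) \<in> E"
    if "Suc i < length (f # g # fs)" for i
    using that by (auto simp: composable_seqs_def)
  from this[of 0] this[of "Suc i" for i] show ?R
    using L by (auto simp: composable_seqs_def Mor_seqs_def)
next
  assume ?R
  then show ?L
    using composable_seqs_append[of "[f]" C E "g # fs"] by (simp add: composable_seqs_single)
qed

lemma composable_seqs_nonempty: "fs \<in> composable_seqs C E \<Longrightarrow> fs \<noteq> []"
  by (auto simp: composable_seqs_def Mor_seqs_def)

lemma composable_seqs_induct [consumes 1, case_names single Cons]:
  assumes "fs \<in> composable_seqs C E"
    and "\<And>f. f \<in> Mor C \<Longrightarrow> P [f]"
    and "\<And>f g fs. \<lbrakk>f \<in> Mor C; (tg C f, sc C g) \<in> E; g # fs \<in> composable_seqs C E; P (g # fs)\<rbrakk>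
      \<Longrightarrow> P (f # g # fs)"
  shows "P fs"
  using assms(1)
proof (induction fs rule: induct_list012)
  case 1
  then show ?case by (auto dest: composable_seqs_nonempty)
next
  case (2 f)
  then show ?case using assms(2) by (simp add: composable_seqs_single)
next
  case (3 f g fs)
  then show ?case using assms(3) by (simp add: composable_seqs_Cons)
qed

lemma (in category) comp_seq_Mor:
  assumes "fs \<in> composable_seqs C Id"
  shows "comp_seq C fs \<in> Mor C \<and> sc C (comp_seq C fs) = sc C (hd fs) \<and>
    tg C (comp_seq C fs) = tg C (last fs)"
  using assms by (induction fs rule: composable_seqs_induct) (auto simp: comp_Mor)

lemma (in category) comp_seq_append:
  assumes "fs \<in> composable_seqs C Id" "gs \<in> composable_seqs C Id" "tg C (last fs) = sc C (hd gs)"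
  shows "comp_seq C (fs @ gs) = comp C (comp_seq C gs) (comp_seq C fs)"
  using assms(1,3)
proof (induction fs rule: composable_seqs_induct)
  case (single f)
  then show ?case using composable_seqs_nonempty[OF assms(2)] by (cases gs) auto
next
  case (Cons f g fs)
  then show ?case
    using comp_seq_Mor[OF Cons(3)] comp_seq_Mor[OF assms(2)]
      assoc[of f "sc C f" "tg C f" "comp_seq C (g # fs)" "tg C (last (g # fs))"
        "comp_seq C gs" "tg C (last gs)"]
    by (simp add: Hom_def)
qed

lemma composable_seqs_map_functor:
  assumes "F \<in> Functors C D" "fs \<in> composable_seqs C (kernel_ob C F)"
  shows "map (mmap F) fs \<in> composable_seqs D Id"
  using assms(2) FunctorsD[OF assms(1)]
  by (induction fs rule: composable_seqs_induct)
    (auto simp: composable_seqs_single composable_seqs_Cons kernel_ob_def,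
     auto simp: composable_seqs_def Mor_seqs_def)

lemma gen_kernel_in_GCgr:
  assumes C: "category C" and D: "category D" and F: "F \<in> Functors C D"
  shows "gen_kernel C D F \<in> GCgr C"
proof -
  interpret C: category C by fact
  interpret D: category D by fact
  note FD = FunctorsD[OF F]
  define E where "E = kernel_ob C F"
  define c where "c = (\<lambda>fs. comp_seq D (map (mmap F) fs))"
  define R where "R = {(fs, gs). fs \<in> composable_seqs C E \<and> gs \<in> composable_seqs C E \<and> c fs = c gs}"
  have K: "gen_kernel C D F = (E, R)" by (simp add: gen_kernel_def E_def R_def c_def)
  have c_sc: "sc D (c fs) = omap F (sc C (hd fs))" and c_tg: "tg D (c fs) = omap F (tg C (last fs))"
    and ends: "sc C (hd fs) \<in> Ob C" "tg C (last fs) \<in> Ob C"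
    if fs: "fs \<in> composable_seqs C E" for fs
  proof -
    have ne: "fs \<noteq> []" and sub: "set fs \<subseteq> Mor C"
      using fs by (auto simp: composable_seqs_def Mor_seqs_def)
    then have "hd fs \<in> Mor C" "last fs \<in> Mor C" by auto
    then show "sc D (c fs) = omap F (sc C (hd fs))" "tg D (c fs) = omap F (tg C (last fs))"
      "sc C (hd fs) \<in> Ob C" "tg C (last fs) \<in> Ob C"
      using D.comp_seq_Mor[OF composable_seqs_map_functor[OF F fs[unfolded E_def]]] ne FD(3,4)
      by (auto simp: c_def hd_map last_map C.sc_in C.tg_in)
  qed
  have c_append: "c (fs @ gs) = comp D (c gs) (c fs)"
    if fs: "fs \<in> composable_seqs C E" and gs: "gs \<in> composable_seqs C E"
      and E: "(tg C (last fs), sc C (hd gs)) \<in> E" for fs gs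
  proof -
    have "fs \<noteq> []" "gs \<noteq> []" using fs gs composable_seqs_nonempty by auto
    moreover have "last fs \<in> Mor C" "hd gs \<in> Mor C"
      using fs gs by (auto simp: composable_seqs_def Mor_seqs_def)
    ultimately show ?thesis
      using D.comp_seq_append[OF composable_seqs_map_functor[OF F fs[unfolded E_def]]
          composable_seqs_map_functor[OF F gs[unfolded E_def]]] E FD(3,4)
      by (auto simp: c_def hd_map last_map E_def kernel_ob_def)
  qed
  have "equiv (Ob C) E"
    by (rule equivI) (auto simp: E_def kernel_ob_def refl_on_def sym_def trans_def)
  moreover have "equiv (composable_seqs C E) R"
    by (rule equivI) (auto simp: R_def refl_on_def sym_def trans_def)
  moreover have "([ident C a], [ident C b]) \<in> R" if "(a, b) \<in> E" for a b
    using that FD(5) by (auto simp: E_def R_def c_def kernel_ob_def composable_seqs_single C.ident_Mor)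
  moreover have "(sc C (hd fs), sc C (hd gs)) \<in> E \<and> (tg C (last fs), tg C (last gs)) \<in> E"
    if "(fs, gs) \<in> R" for fs gs
  proof -
    have "fs \<in> composable_seqs C E" "gs \<in> composable_seqs C E" "c fs = c gs"
      using that by (auto simp: R_def)
    then show ?thesis using c_sc[of fs] c_tg[of fs] c_sc[of gs] c_tg[of gs] ends[of fs] ends[of gs]
      by (auto simp: E_def kernel_ob_def)
  qed
  moreover have "([f, g], [comp C g f]) \<in> R" if "f \<in> Mor C" "g \<in> Mor C" "sc C g = tg C f" for f g
    using that FD(6) C.tg_in[OF that(1)]
    by (auto simp: R_def c_def E_def kernel_ob_def composable_seqs_single composable_seqs_Cons C.comp_Mor)
  moreover have "(fs @ gs, fs' @ gs') \<in> R"
    if "(fs, fs') \<in> R" "(gs, gs') \<in> R" "(tg C (last fs), sc C (hd gs)) \<in> E" for fs fs' gs gs'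
  proof -
    have mem: "fs \<in> composable_seqs C E" "fs' \<in> composable_seqs C E" "c fs = c fs'"
      "gs \<in> composable_seqs C E" "gs' \<in> composable_seqs C E" "c gs = c gs'"
      using that by (auto simp: R_def)
    moreover have "(tg C (last fs'), sc C (hd gs')) \<in> E"
      using that(3) c_tg[OF mem(1)] c_tg[OF mem(2)] c_sc[OF mem(4)] c_sc[OF mem(5)] mem(3,6)
        ends[OF mem(2)] ends[OF mem(5)]
      by (auto simp: E_def kernel_ob_def)
    ultimately show ?thesis
      using that(3) by (auto simp: R_def c_append composable_seqs_append)
  qed
  ultimately show ?thesis unfolding K GCgr_def by auto
qed


section \<open>Strong generalized congruences\<close>

lemma GCgrD:
  assumes "(E, R) \<in> GCgr C"
  shows "equiv (Ob C) E" "equiv (composable_seqs C E) R"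
    and "\<lbrakk>f \<in> Mor C; g \<in> Mor C; sc C g = tg C f\<rbrakk> \<Longrightarrow> ([f, g], [comp C g f]) \<in> R"
    and "\<lbrakk>(fs, fs') \<in> R; (gs, gs') \<in> R; (tg C (last fs), sc C (hd gs)) \<in> E\<rbrakk>
      \<Longrightarrow> (fs @ gs, fs' @ gs') \<in> R"
  using assms by (auto simp: GCgr_def)

text \<open>Composing from the right, strength moves the composite of the tail so that it starts
  exactly where the first morphism ends.\<close>

lemma strong_sequence_equiv_single:
  assumes C: "category C" and strong: "(E, R) \<in> SGCgr C" and fs: "fs \<in> composable_seqs C E"
  shows "\<exists>f\<in>Mor C. sc C f = sc C (hd fs) \<and> (fs, [f]) \<in> R"
proof -
  interpret category C by fact
  have G: "(E, R) \<in> GCgr C" using strong by (simp add: SGCgr_def)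
  have reflR: "(gs, gs) \<in> R" if "gs \<in> composable_seqs C E" for gs
    using GCgrD(2)[OF G] that by (auto simp: equiv_def refl_on_def)
  have transR: "trans R" using GCgrD(2)[OF G] by (simp add: equiv_def)
  from fs show ?thesis
  proof (induction fs rule: composable_seqs_induct)
    case (single f)
    then show ?case using reflR by (auto simp: composable_seqs_single)
  next
    case (Cons f g fs)
    obtain h where h: "h \<in> Mor C" "sc C h = sc C g" "(g # fs, [h]) \<in> R" using Cons(4) by auto
    have "(sc C h, tg C f) \<in> E" "(tg C h, tg C h) \<in> E"
      using GCgrD(1)[OF G] Cons(2) h tg_in[OF h(1)]
      by (auto simp: equiv_def refl_on_def dest: symD)
    then obtain h' where h': "h' \<in> Mor C" "sc C h' = tg C f" "([h], [h']) \<in> R"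
      using strong h(1) unfolding SGCgr_def Hom_def by (simp) blast
    have "(g # fs, [h']) \<in> R" using h(3) h'(3) transR by (blast dest: transD)
    then have "([f] @ g # fs, [f] @ [h']) \<in> R"
      using Cons(1,2) by (intro GCgrD(4)[OF G] reflR) (auto simp: composable_seqs_single)
    moreover have "([f, h'], [comp C h' f]) \<in> R" using GCgrD(3)[OF G Cons(1) h'(1,2)] .
    ultimately have "(f # g # fs, [comp C h' f]) \<in> R"
      using transR by (auto dest: transD)
    then show ?case using Cons(1) h' by (auto simp: comp_Mor intro!: bexI[of _ "comp C h' f"])
  qed
qed

text \<open>The congruence generated by the object part and the pairs of single morphisms inherits
  strength, since strength is witnessed by such pairs. So already there each sequence is equivalent
  to a single morphism, and single morphisms are identified as required by the generators.\<close>

lemma strong_imp_regular: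
  assumes C: "category C" and strong: "\<Psi> \<in> SGCgr C"
  shows "\<Psi> \<in> RgGCgr C"
proof -
  obtain E R where \<Psi>: "\<Psi> = (E, R)" by (cases \<Psi>)
  have G: "(E, R) \<in> GCgr C" using strong by (simp add: SGCgr_def \<Psi>)
  define S where "S = (E, {([f], [g]) | f g. ([f], [g]) \<in> R})"
  obtain E' R' where gen: "generated_GCgr C S = (E', R')" by (cases "generated_GCgr C S")
  have E: "E \<subseteq> Ob C \<times> Ob C" and R: "R \<subseteq> composable_seqs C E \<times> composable_seqs C E"
    using GCgrD(1,2)[OF G] by (auto simp: equiv_def)
  then have S: "fst S \<subseteq> Ob C \<times> Ob C" "snd S \<subseteq> Mor_seqs C \<times> Mor_seqs C"
    by (auto simp: S_def composable_seqs_def)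
  note least = generated_GCgr_least[OF C S, unfolded gen fst_conv snd_conv]
  have single: "([f], [g]) \<in> R'" if "([f], [g]) \<in> R" for f g
    using least(3) that by (auto simp: S_def)
  have sub: "E' \<subseteq> E" "R' \<subseteq> R"
    using least(4)[OF G] by (auto simp: S_def)
  have E_eq: "E' = E" using least(2) sub(1) by (auto simp: S_def)
  have G': "(E, R') \<in> GCgr C" using least(1) E_eq by simp
  have strong': "(E, R') \<in> SGCgr C"
    unfolding SGCgr_def
  proof (clarsimp simp: G')
    fix a a' b b' f
    assume "(a, a') \<in> E" "(b, b') \<in> E" "f \<in> Hom C a b"
    then obtain f' where "f' \<in> Hom C a' b'" "([f], [f']) \<in> R"
      using strong unfolding SGCgr_def \<Psi> by (simp) blast
    then show "\<exists>f'\<in>Hom C a' b'. ([f], [f']) \<in> R'" using single by auto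
  qed
  have equivR: "equiv (composable_seqs C E) R" "equiv (composable_seqs C E) R'"
    using GCgrD(2)[OF G] GCgrD(2)[OF G'] by simp_all
  have "R \<subseteq> R'"
  proof clarify
    fix fs gs assume fg: "(fs, gs) \<in> R"
    then have "fs \<in> composable_seqs C E" "gs \<in> composable_seqs C E" using R by auto
    then obtain f g where f: "(fs, [f]) \<in> R'" and g: "(gs, [g]) \<in> R'"
      using strong_sequence_equiv_single[OF C strong'] by blast
    then have "([f], [g]) \<in> R"
      using fg sub(2) equivR(1) by (meson equivE subsetD symD transD)
    then show "(fs, gs) \<in> R'"
      using f g single equivR(2) by (meson equivE symD transD)
  qed
  then have "(E, R) = generated_GCgr C S" using gen E_eq sub(2) by auto
  then show ?thesis using G unfolding RgGCgr_def S_def \<Psi> by (intro CollectI case_prodI conjI)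
qed

text \<open>In elementary terms, strength of the kernel is the transport of morphisms along
  identifications of objects, without changing the image.\<close>

lemma gen_kernel_strong_iff:
  assumes C: "category C" and D: "category D" and F: "F \<in> Functors C D"
  shows "gen_kernel C D F \<in> SGCgr C \<longleftrightarrow>
    (\<forall>f\<in>Mor C. \<forall>a\<in>Ob C. \<forall>b\<in>Ob C. omap F a = omap F (sc C f) \<and> omap F b = omap F (tg C f) \<longrightarrow>
      (\<exists>f'\<in>Hom C a b. mmap F f' = mmap F f))" (is "?L \<longleftrightarrow> ?R")
proof -
  interpret category C by fact
  show ?thesis
  proof
    assume L: ?L
    show ?R
    proof (intro ballI impI)
      fix f a b
      assume f: "f \<in> Mor C" "a \<in> Ob C" "b \<in> Ob C"
        "omap F a = omap F (sc C f) \<and> omap F b = omap F (tg C f)"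
      then have "(sc C f, a) \<in> kernel_ob C F" "(tg C f, b) \<in> kernel_ob C F"
        "f \<in> Hom C (sc C f) (tg C f)"
        by (auto simp: kernel_ob_def sc_in tg_in Hom_def)
      then have "\<exists>f'\<in>Hom C a b. ([f], [f']) \<in> snd (gen_kernel C D F)"
        using L unfolding SGCgr_def gen_kernel_def prod.case mem_Collect_eq snd_conv by blast
      then show "\<exists>f'\<in>Hom C a b. mmap F f' = mmap F f" by (auto simp: gen_kernel_def)
    qed
  next
    assume R: ?R
    have "\<exists>f'\<in>Hom C a' b'. ([f], [f']) \<in> snd (gen_kernel C D F)"
      if "(a, a') \<in> kernel_ob C F" "(b, b') \<in> kernel_ob C F" "f \<in> Hom C a b" for a a' b b' f
    proof -
      have f: "f \<in> Mor C" "sc C f = a" "tg C f = b" using that(3) by (auto simp: Hom_def)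
      moreover have "a' \<in> Ob C" "b' \<in> Ob C" "omap F a' = omap F a" "omap F b' = omap F b"
        using that by (auto simp: kernel_ob_def)
      ultimately obtain f' where f': "f' \<in> Hom C a' b'" "mmap F f' = mmap F f"
        using R by metis
      have "f' \<in> Mor C" using f'(1) by (simp add: Hom_def)
      then show ?thesis using f' f(1) by (auto simp: gen_kernel_def composable_seqs_single)
    qed
    then show ?L
      using gen_kernel_in_GCgr[OF C D F] unfolding SGCgr_def by (auto simp: gen_kernel_def)
  qed
qed


section \<open>Full functors that are surjective on objects\<close>

lemma full_surjective_onto_Mor:
  assumes D: "category D" and F: "F \<in> Functors C D"
    and full: "full_functor C D F" and surj: "surjective_on_objects C D F"
  shows "mmap F ` Mor C = Mor D"
proof
  interpret D: category D by fact
  show "mmap F ` Mor C \<subseteq> Mor D" using FunctorsD(2)[OF F] by auto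
  show "Mor D \<subseteq> mmap F ` Mor C"
  proof
    fix d assume d: "d \<in> Mor D"
    obtain a b where ab: "a \<in> Ob C" "b \<in> Ob C" "sc D d = omap F a" "tg D d = omap F b"
      using surj D.sc_in[OF d] D.tg_in[OF d] unfolding surjective_on_objects_def by blast
    then have "d \<in> Hom D (omap F a) (omap F b)" using d by (simp add: Hom_def)
    then have "d \<in> mmap F ` Hom C a b" using full ab by (simp add: full_functor_def)
    then show "d \<in> mmap F ` Mor C" by (auto simp: Hom_def)
  qed
qed

lemma extremal_epi_if_onto_Mor:
  assumes U: "grothendieck_universe elts" and D: "category D"
    and F: "F \<in> Functors C D" and onto: "mmap F ` Mor C = Mor D"
  shows "extremal_epi_Cat elts C D F"
proof -
  have "G = H"
    if "G \<in> Functors D X" "H \<in> Functors D X" and eq: "comp_functor C G F = comp_functor C H F"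
    for X G H
  proof (rule functor_eqI[OF D that(1,2)])
    fix d assume "d \<in> Mor D"
    then obtain f where f: "f \<in> Mor C" "d = mmap F f" using onto by auto
    then show "mmap G d = mmap H d"
      using arg_cong[OF eq, of "\<lambda>K. mmap K f"] by (simp add: comp_functor_apply)
  qed
  then have "epi_Cat elts C D F" using F by (auto simp: epi_Cat_def)
  moreover have "iso_Cat X D M"
    if X: "X \<in> U_categories elts" and G: "G \<in> Functors C X" and M: "mono_Cat elts X D M"
      and eq: "F = comp_functor C M G" for X G M
  proof -
    have X': "category X" using X by (simp add: U_categories_def)
    have MF: "M \<in> Functors X D" using M by (simp add: mono_Cat_def)
    have "mmap F f \<in> mmap M ` Mor X" if "f \<in> Mor C" for f
      using that FunctorsD(2)[OF G that] by (simp add: eq comp_functor_apply)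
    then have "mmap M ` Mor X = Mor D"
      using onto FunctorsD(2)[OF MF] by (metis image_subsetI subset_antisym)
    then show ?thesis
      using mono_Cat_inj[OF U X' M] by (intro iso_CatI[OF X' D MF]) (simp add: bij_betw_def)
  qed
  ultimately show ?thesis by (auto simp: extremal_epi_Cat_def)
qed

text \<open>This need not be a category: \<open>F\<close> may identify the target of \<open>f\<close> with the source of \<open>g\<close>, and
  then \<open>F(g) \<circ> F(f)\<close> is a composite in \<open>D\<close> without having to be the image of a morphism.\<close>

definition image_category :: "'u category \<Rightarrow> 'u category \<Rightarrow> 'u cat_functor \<Rightarrow> 'u category" where
  "image_category C D F = D\<lparr>Ob := omap F ` Ob C, Mor := mmap F ` Mor C\<rparr>"

text \<open>Strength repairs this by replacing \<open>g\<close> with a morphism of the same image that starts at the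
  target of \<open>f\<close>. Hom-sets remain in the universe because it contains all subsets of its elements.\<close>

lemma image_category_in_U_categories:
  assumes U: "grothendieck_universe elts"
    and C: "category C" and D: "D \<in> U_categories elts" and F: "F \<in> Functors C D"
    and strong: "gen_kernel C D F \<in> SGCgr C"
  shows "image_category C D F \<in> U_categories elts"
proof -
  interpret grothendieck_universe elts by fact
  interpret C: category C by fact
  have D': "category D" using D by (simp add: U_categories_def)
  interpret D: category D by fact
  note FD = FunctorsD[OF F]
  let ?I = "image_category C D F"
  have [simp]: "Ob ?I = omap F ` Ob C" "Mor ?I = mmap F ` Mor C" "sc ?I = sc D" "tg ?I = tg D"
    "ident ?I = ident D" "comp ?I = comp D"
    by (simp_all add: image_category_def)
  have HomI: "Hom ?I x y = Hom D x y \<inter> mmap F ` Mor C" for x y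
    using FD(2) by (auto simp: Hom_def)
  have closed: "comp D e d \<in> mmap F ` Mor C"
    if de: "d \<in> mmap F ` Mor C" "e \<in> mmap F ` Mor C" "sc D e = tg D d" for d e
  proof -
    obtain f g where f: "f \<in> Mor C" "d = mmap F f" and g: "g \<in> Mor C" "e = mmap F g"
      using de by auto
    have "omap F (tg C f) = omap F (sc C g)" using de(3) f g FD(3,4) by simp
    then obtain g' where "g' \<in> Hom C (tg C f) (tg C g)" "mmap F g' = e"
      using strong[unfolded gen_kernel_strong_iff[OF C D' F]] f g by (metis C.tg_in)
    then have "g' \<in> Mor C" "sc C g' = tg C f" "mmap F (comp C g' f) = comp D e d"
      using FD(6)[of f g'] f by (auto simp: Hom_def)
    then show ?thesis using C.comp_Mor(1)[OF f(1)] by (metis imageI)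
  qed
  have "category ?I"
  proof
    fix f a b g c assume "f \<in> Hom ?I a b" "g \<in> Hom ?I b c"
    then show "comp ?I g f \<in> Hom ?I a c"
      using D.comp_in[of f a b g c] closed[of f g] by (auto simp: HomI) (auto simp: Hom_def)
  next
    fix a assume "a \<in> Ob ?I"
    then obtain x where x: "x \<in> Ob C" "a = omap F x" by auto
    then have "ident D a = mmap F (ident C x)" using FD(5) by simp
    then show "ident ?I a \<in> Hom ?I a a"
      using x D.ident_in[of a] FD(1) C.ident_Mor(1)[OF x(1)] by (auto simp: HomI)
  qed (auto simp: HomI FD C.sc_in C.tg_in D.ident_right D.ident_left intro: D.assoc)
  moreover have "Hom ?I x y \<in> range elts" if "x \<in> Ob ?I" "y \<in> Ob ?I" for x y
  proof -
    have "Hom D x y \<in> range elts" using D that FD(1) by (auto simp: U_categories_def)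
    then obtain u where "elts u = Hom D x y" by auto
    then show ?thesis using subset_in_universe[of "Hom ?I x y" u] by (simp add: HomI)
  qed
  ultimately show ?thesis by (simp add: U_categories_def)
qed

lemma extremal_epi_CatD:
  assumes "extremal_epi_Cat elts C D F" "X \<in> U_categories elts" "G \<in> Functors C X"
    and "mono_Cat elts X D M" "F = comp_functor C M G"
  shows "iso_Cat X D M"
  using assms unfolding extremal_epi_Cat_def by blast

text \<open>An extremal epimorphism cannot factor through a proper subcategory.\<close>

lemma extremal_epi_onto_image:
  assumes I: "image_category C D F \<in> U_categories elts" and C: "category C"
    and ext: "extremal_epi_Cat elts C D F"
  shows "omap F ` Ob C = Ob D" "mmap F ` Mor C = Mor D"
proof -
  let ?I = "image_category C D F"
  have F: "F \<in> Functors C D" using ext by (simp add: extremal_epi_Cat_def epi_Cat_def)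
  note FD = FunctorsD[OF F]
  have [simp]: "Ob ?I = omap F ` Ob C" "Mor ?I = mmap F ` Mor C" "sc ?I = sc D" "tg ?I = tg D"
    "ident ?I = ident D" "comp ?I = comp D"
    by (simp_all add: image_category_def)
  have I': "category ?I" using I by (simp add: U_categories_def)
  define M where "M = id_functor ?I"
  have "omap M \<in> omap F ` Ob C \<rightarrow>\<^sub>E Ob D" "mmap M \<in> mmap F ` Mor C \<rightarrow>\<^sub>E Mor D"
    using FD(1,2) by (auto simp: M_def id_functor_def)
  then have M: "M \<in> Functors ?I D"
    using FunctorsD(3-6)[OF id_functor_in[OF I'], folded M_def] by (simp add: Functors_def)
  have "omap F \<in> Ob C \<rightarrow>\<^sub>E omap F ` Ob C" "mmap F \<in> Mor C \<rightarrow>\<^sub>E mmap F ` Mor C"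
    using F by (simp_all add: Functors_def PiE_iff)
  then have G: "F \<in> Functors C ?I" using FD(3-6) by (simp add: Functors_def)
  have "mono_Cat elts ?I D M"
    unfolding mono_Cat_def
  proof (intro conjI M ballI impI)
    fix X G H assume X: "X \<in> U_categories elts" and GH: "G \<in> Functors X ?I" "H \<in> Functors X ?I"
      and eq: "comp_functor X M G = comp_functor X M H"
    show "G = H"
    proof (rule functor_eqI[OF _ GH])
      show "category X" using X by (simp add: U_categories_def)
      fix f assume f: "f \<in> Mor X"
      note FunctorsD(2)[OF GH(1) f] FunctorsD(2)[OF GH(2) f]
      then show "mmap G f = mmap H f"
        using arg_cong[OF eq, of "\<lambda>K. mmap K f"] f
        by (simp add: comp_functor_apply M_def id_functor_def)
    qed
  qed
  moreover have "F = comp_functor C M F"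
    by (rule functor_eqI[OF C F comp_functor_in[OF C G M]])
      (simp add: comp_functor_apply M_def id_functor_def)
  ultimately have "iso_Cat ?I D M" by (rule extremal_epi_CatD[OF ext I G])
  note onto = iso_Cat_surjective[OF this]
  show "omap F ` Ob C = Ob D" using onto(1) by (simp add: M_def id_functor_def)
  show "mmap F ` Mor C = Mor D" using onto(2) by (simp add: M_def id_functor_def)
qed

theorem proposition2p35:
  fixes elts :: "'u \<Rightarrow> 'u set" and C D :: "'u category" and F :: "'u cat_functor"
  assumes "grothendieck_universe elts"
    and "C \<in> U_categories elts" and "D \<in> U_categories elts"
    and "F \<in> Functors C D"
  shows "full_functor C D F \<and> surjective_on_objects C D F \<longleftrightarrow>
    extremal_epi_Cat elts C D F \<and> gen_kernel C D F \<in> RgGCgr C \<inter> SGCgr C"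
proof -
  have C: "category C" and D: "category D" using assms(2,3) by (auto simp: U_categories_def)
  interpret C: category C by fact
  note F = assms(4) and FD = FunctorsD[OF assms(4)]
  show ?thesis
  proof
    assume fs: "full_functor C D F \<and> surjective_on_objects C D F"
    have "extremal_epi_Cat elts C D F"
      using fs extremal_epi_if_onto_Mor[OF assms(1) D F full_surjective_onto_Mor[OF D F]] by simp
    moreover have strong: "gen_kernel C D F \<in> SGCgr C"
      unfolding gen_kernel_strong_iff[OF C D F]
    proof (intro ballI impI)
      fix f a b
      assume f: "f \<in> Mor C" "a \<in> Ob C" "b \<in> Ob C"
        "omap F a = omap F (sc C f) \<and> omap F b = omap F (tg C f)"
      then have "mmap F f \<in> Hom D (omap F a) (omap F b)" using FD by (simp add: Hom_def)
      also have "\<dots> = mmap F ` Hom C a b" using fs f by (simp add: full_functor_def)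
      finally show "\<exists>f'\<in>Hom C a b. mmap F f' = mmap F f" by auto
    qed
    ultimately show "extremal_epi_Cat elts C D F \<and> gen_kernel C D F \<in> RgGCgr C \<inter> SGCgr C"
      using strong_imp_regular[OF C strong] by auto
  next
    assume R: "extremal_epi_Cat elts C D F \<and> gen_kernel C D F \<in> RgGCgr C \<inter> SGCgr C"
    then have strong: "gen_kernel C D F \<in> SGCgr C" by simp
    have I: "image_category C D F \<in> U_categories elts"
      by (rule image_category_in_U_categories[OF assms(1) C assms(3) F strong])
    have onto: "omap F ` Ob C = Ob D" "mmap F ` Mor C = Mor D"
      using extremal_epi_onto_image[OF I C] R by auto
    have "mmap F ` Hom C a b = Hom D (omap F a) (omap F b)" if ab: "a \<in> Ob C" "b \<in> Ob C" for a b
    proof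
      show "mmap F ` Hom C a b \<subseteq> Hom D (omap F a) (omap F b)" using FD by (auto simp: Hom_def)
      show "Hom D (omap F a) (omap F b) \<subseteq> mmap F ` Hom C a b"
      proof
        fix d assume d: "d \<in> Hom D (omap F a) (omap F b)"
        then obtain f where f: "f \<in> Mor C" "d = mmap F f" using onto(2) by (auto simp: Hom_def)
        then have "omap F a = omap F (sc C f) \<and> omap F b = omap F (tg C f)"
          using d FD(3,4) by (auto simp: Hom_def)
        then show "d \<in> mmap F ` Hom C a b"
          using strong[unfolded gen_kernel_strong_iff[OF C D F]] f ab by (metis imageI)
      qed
    qed
    then show "full_functor C D F \<and> surjective_on_objects C D F"
      using onto(1) by (auto simp: full_functor_def surjective_on_objects_def)
  qed
qed

end
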